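(* Let $R$ be a ring and $\alpha$ an endomorphism of $R$. Then the following conditions are equivalent: (i) the skew power series ring $R[[x;\alpha]]$ is a reduced left Archimedean ring; (ii) $R$ is a left Archimedean ring and $\alpha$ is rigid; (iii) $R$ is a reduced left Archimedean ring and $\alpha$ is compatible.
   Context: Rings are associative with unity, not necessarily commutative; endomorphisms are (unital) ring endomorphisms. $U(A)$ denotes the group of units (two-sided invertible elements) of a ring $A$. $\mathbb{N}$ is the set of positive integers. A ring $A$ is left Archimedean if $\bigcap_{n\in\mathbb{N}} a^nA = 0$ for every $a\in A\setminus U(A)$. A ring is reduced if it has no nonzero nilpotent elements. The skew power series ring $R[[x;\alpha]]$ consists of power series over $R$ in the variable $x$ with coefficients written on the left of powers of $x$, with term-wise addition and with multiplication subject to the relation $xa=\alpha(a)x$ for $a\in R$. An endomorphism $\alpha$ of $R$ is rigid if, for any $a\in R$, $a\alpha(a)=0$ implies $a=0$. It is compatible if for any $a,b\in R$ we have $ab=0$ if and only if $a\alpha(b)=0$. *)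

theory Defs
  imports "HOL-Algebra.QuotRing"
begin

definition left_archimedean :: "('a, 'm) ring_scheme \<Rightarrow> bool" where
  "left_archimedean A \<longleftrightarrow>
    (\<forall>a \<in> carrier A - Units A.
      (\<Inter>n \<in> {1::nat..}. (a [^]\<^bsub>A\<^esub> n) <#\<^bsub>A\<^esub> carrier A) = {\<zero>\<^bsub>A\<^esub>})"

definition nilpotent_elem :: "('a, 'm) ring_scheme \<Rightarrow> 'a \<Rightarrow> bool" where
  "nilpotent_elem A a \<longleftrightarrow> a \<in> carrier A \<and> (\<exists>n::nat. n \<ge> 1 \<and> a [^]\<^bsub>A\<^esub> n = \<zero>\<^bsub>A\<^esub>)"

definition reduced :: "('a, 'm) ring_scheme \<Rightarrow> bool" where
  "reduced A \<longleftrightarrow> (\<forall>a. nilpotent_elem A a \<longrightarrow> a = \<zero>\<^bsub>A\<^esub>)"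

definition rigid_endo :: "('a, 'm) ring_scheme \<Rightarrow> ('a \<Rightarrow> 'a) \<Rightarrow> bool" where
  "rigid_endo R \<alpha> \<longleftrightarrow>
    (\<forall>a \<in> carrier R. a \<otimes>\<^bsub>R\<^esub> \<alpha> a = \<zero>\<^bsub>R\<^esub> \<longrightarrow> a = \<zero>\<^bsub>R\<^esub>)"

definition compatible_endo :: "('a, 'm) ring_scheme \<Rightarrow> ('a \<Rightarrow> 'a) \<Rightarrow> bool" where
  "compatible_endo R \<alpha> \<longleftrightarrow>
    (\<forall>a \<in> carrier R. \<forall>b \<in> carrier R.
      a \<otimes>\<^bsub>R\<^esub> b = \<zero>\<^bsub>R\<^esub> \<longleftrightarrow> a \<otimes>\<^bsub>R\<^esub> \<alpha> b = \<zero>\<^bsub>R\<^esub>)"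

text \<open>
  The series with left coefficients \<open>f 0, f 1, f 2, \<dots>\<close> is represented by its coefficient
  function \<open>f\<close>. Since \<open>x a = \<alpha>(a) x\<close> gives
  \<open>(a x\<^sup>i) (b x\<^sup>j) = a \<alpha>\<^sup>i(b) x\<^sup>i\<^sup>+\<^sup>j\<close>, the \<open>n\<close>-th coefficient of \<open>f g\<close> is the sum
  of \<open>f i \<alpha>\<^sup>i(g (n - i))\<close> over \<open>i \<le> n\<close>.
\<close>

definition skew_power_series ::
    "('a, 'm) ring_scheme \<Rightarrow> ('a \<Rightarrow> 'a) \<Rightarrow> (nat \<Rightarrow> 'a) ring" where
  "skew_power_series R \<alpha> =
    \<lparr> carrier = UNIV \<rightarrow> carrier R,
      mult = (\<lambda>f g n. \<Oplus>\<^bsub>R\<^esub>i \<in> {..n}. f i \<otimes>\<^bsub>R\<^esub> (\<alpha> ^^ i) (g (n - i))),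
      one = (\<lambda>n. if n = 0 then \<one>\<^bsub>R\<^esub> else \<zero>\<^bsub>R\<^esub>),
      zero = (\<lambda>n. \<zero>\<^bsub>R\<^esub>),
      add = (\<lambda>f g n. f n \<oplus>\<^bsub>R\<^esub> g n) \<rparr>"

context ring
begin

lemma funpow_endo_closed:
  assumes "\<alpha> \<in> ring_hom R R" "a \<in> carrier R"
  shows "(\<alpha> ^^ i) a \<in> carrier R"
  using assms by (induction i) (auto intro: ring_hom_closed)

lemma funpow_endo:
  assumes "\<alpha> \<in> ring_hom R R"
  shows "(\<alpha> ^^ i) \<in> ring_hom R R"
proof (rule ring_hom_memI)
  show "(\<alpha> ^^ i) x \<in> carrier R" if "x \<in> carrier R" for x
    using assms that by (rule funpow_endo_closed)
  show "(\<alpha> ^^ i) (x \<otimes> y) = (\<alpha> ^^ i) x \<otimes> (\<alpha> ^^ i) y" if "x \<in> carrier R" "y \<in> carrier R" for x y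
    using that assms by (induction i) (auto simp: ring_hom_mult funpow_endo_closed)
  show "(\<alpha> ^^ i) (x \<oplus> y) = (\<alpha> ^^ i) x \<oplus> (\<alpha> ^^ i) y" if "x \<in> carrier R" "y \<in> carrier R" for x y
    using that assms by (induction i) (auto simp: ring_hom_add funpow_endo_closed)
  show "(\<alpha> ^^ i) \<one> = \<one>"
    using assms by (induction i) (auto simp: ring_hom_one)
qed

lemma endo_zero:
  assumes "h \<in> ring_hom R R"
  shows "h \<zero> = \<zero>"
  using ring_hom_zero[OF assms] ring_axioms by blast

lemma endo_finsum:
  assumes "h \<in> ring_hom R R" "t \<in> UNIV \<rightarrow> carrier R"
  shows "h (\<Oplus>j \<in> {..n::nat}. t j) = (\<Oplus>j \<in> {..n}. h (t j))"
proof -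
  have c: "t j \<in> carrier R" "h (t j) \<in> carrier R" for j
    using assms by (auto intro: ring_hom_closed)
  show ?thesis
    by (induction n) (use assms(1) c in \<open>auto simp: ring_hom_add\<close>)
qed

lemma finsum_triangle:
  assumes "\<And>i j. t i j \<in> carrier R"
  shows "(\<Oplus>k \<in> {..n::nat}. \<Oplus>i \<in> {..k}. t i (k - i)) = (\<Oplus>i \<in> {..n}. \<Oplus>j \<in> {..n - i}. t i j)"
proof (induction n)
  case 0
  then show ?case using assms by simp
next
  case (Suc n)
  have "(\<Oplus>i \<in> {..n}. \<Oplus>j \<in> {..Suc n - i}. t i j)
      = (\<Oplus>i \<in> {..n}. (\<Oplus>j \<in> {..n - i}. t i j) \<oplus> t i (Suc n - i))"
    by (rule finsum_cong') (auto simp: assms Suc_diff_le a_comm)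
  also have "\<dots> = (\<Oplus>i \<in> {..n}. \<Oplus>j \<in> {..n - i}. t i j) \<oplus> (\<Oplus>i \<in> {..n}. t i (Suc n - i))"
    by (rule finsum_addf) (auto simp: assms)
  finally show ?case
    using Suc by (simp add: assms a_ac)
qed

lemma finsum_delta_nat:
  assumes "t \<in> UNIV \<rightarrow> carrier R"
  shows "(\<Oplus>i \<in> {..n::nat}. if i = m then t i else \<zero>) = (if m \<le> n then t m else \<zero>)"
  using assms by (induction n) (auto simp: le_Suc_eq Pi_iff)

lemma skew_power_series_ring:
  assumes \<alpha>: "\<alpha> \<in> ring_hom R R"
  shows "ring (skew_power_series R \<alpha>)" (is "ring ?S")
proof -
  note [simp] = funpow_endo_closed[OF \<alpha>]
  note hom = funpow_endo[OF \<alpha>]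
  have c [simp]: "f n \<in> carrier R" if "f \<in> UNIV \<rightarrow> carrier R" for f and n :: nat
    using that by auto
  show ?thesis
  proof (rule ringI)
    show "abelian_group ?S"
    proof (rule abelian_groupI)
      fix f assume "f \<in> carrier ?S"
      then show "\<exists>g \<in> carrier ?S. g \<oplus>\<^bsub>?S\<^esub> f = \<zero>\<^bsub>?S\<^esub>"
        by (intro bexI[where x = "\<lambda>n. \<ominus> f n"]) (auto simp: skew_power_series_def l_neg)
    qed (auto simp: skew_power_series_def a_ac)
    show "Group.monoid ?S"
    proof (rule monoidI)
      show "f \<otimes>\<^bsub>?S\<^esub> g \<in> carrier ?S" if "f \<in> carrier ?S" "g \<in> carrier ?S" for f g
        using that by (auto simp: skew_power_series_def intro!: finsum_closed)
      show "\<one>\<^bsub>?S\<^esub> \<in> carrier ?S"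
        by (auto simp: skew_power_series_def)
      show "\<one>\<^bsub>?S\<^esub> \<otimes>\<^bsub>?S\<^esub> f = f" if "f \<in> carrier ?S" for f
      proof
        fix n
        have f: "f \<in> UNIV \<rightarrow> carrier R" using that by (simp add: skew_power_series_def)
        have "(\<Oplus>i \<in> {..n}. (if i = 0 then \<one> else \<zero>) \<otimes> (\<alpha> ^^ i) (f (n - i)))
            = (\<Oplus>i \<in> {..n}. if i = 0 then (\<alpha> ^^ i) (f (n - i)) else \<zero>)"
          using f by (intro finsum_cong') auto
        also have "\<dots> = f n"
          using f by (subst finsum_delta_nat) auto
        finally show "(\<one>\<^bsub>?S\<^esub> \<otimes>\<^bsub>?S\<^esub> f) n = f n" by (simp add: skew_power_series_def)
      qed
      show "f \<otimes>\<^bsub>?S\<^esub> \<one>\<^bsub>?S\<^esub> = f" if "f \<in> carrier ?S" for f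
      proof
        fix n
        have f: "f \<in> UNIV \<rightarrow> carrier R" using that by (simp add: skew_power_series_def)
        have "(\<Oplus>i \<in> {..n}. f i \<otimes> (\<alpha> ^^ i) (if n - i = 0 then \<one> else \<zero>))
            = (\<Oplus>i \<in> {..n}. if i = n then f i else \<zero>)"
          using f by (intro finsum_cong') (auto simp: ring_hom_one[OF hom] endo_zero[OF hom])
        also have "\<dots> = f n"
          using f by (subst finsum_delta_nat) auto
        finally show "(f \<otimes>\<^bsub>?S\<^esub> \<one>\<^bsub>?S\<^esub>) n = f n" by (simp add: skew_power_series_def)
      qed
      show "(f \<otimes>\<^bsub>?S\<^esub> g) \<otimes>\<^bsub>?S\<^esub> h = f \<otimes>\<^bsub>?S\<^esub> (g \<otimes>\<^bsub>?S\<^esub> h)"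
        if "f \<in> carrier ?S" "g \<in> carrier ?S" "h \<in> carrier ?S" for f g h
      proof
        fix n
        have fgh: "f \<in> UNIV \<rightarrow> carrier R" "g \<in> UNIV \<rightarrow> carrier R" "h \<in> UNIV \<rightarrow> carrier R"
          using that by (simp_all add: skew_power_series_def)
        define t where "t i j = f i \<otimes> ((\<alpha> ^^ i) (g j) \<otimes> (\<alpha> ^^ (i + j)) (h (n - (i + j))))" for i j
        have t: "t i j \<in> carrier R" for i j using fgh by (simp add: t_def)
        have "(\<Oplus>k \<in> {..n}. (\<Oplus>i \<in> {..k}. f i \<otimes> (\<alpha> ^^ i) (g (k - i))) \<otimes> (\<alpha> ^^ k) (h (n - k)))
            = (\<Oplus>k \<in> {..n}. \<Oplus>i \<in> {..k}. t i (k - i))"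
        proof (rule finsum_cong')
          fix k assume "k \<in> {..n}"
          have "(\<Oplus>i \<in> {..k}. f i \<otimes> (\<alpha> ^^ i) (g (k - i))) \<otimes> (\<alpha> ^^ k) (h (n - k))
              = (\<Oplus>i \<in> {..k}. f i \<otimes> (\<alpha> ^^ i) (g (k - i)) \<otimes> (\<alpha> ^^ k) (h (n - k)))"
            using fgh by (intro finsum_ldistr) auto
          also have "\<dots> = (\<Oplus>i \<in> {..k}. t i (k - i))"
            using fgh t by (intro finsum_cong') (auto simp: t_def m_assoc)
          finally show "(\<Oplus>i \<in> {..k}. f i \<otimes> (\<alpha> ^^ i) (g (k - i))) \<otimes> (\<alpha> ^^ k) (h (n - k))
              = (\<Oplus>i \<in> {..k}. t i (k - i))" .
        qed (use t in auto)
        also have "\<dots> = (\<Oplus>i \<in> {..n}. \<Oplus>j \<in> {..n - i}. t i j)"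
          by (rule finsum_triangle) (rule t)
        also have "\<dots> = (\<Oplus>i \<in> {..n}. f i \<otimes>
            (\<alpha> ^^ i) (\<Oplus>j \<in> {..n - i}. g j \<otimes> (\<alpha> ^^ j) (h (n - i - j))))"
        proof (rule finsum_cong')
          fix i assume "i \<in> {..n}"
          have "(\<alpha> ^^ i) (\<Oplus>j \<in> {..n - i}. g j \<otimes> (\<alpha> ^^ j) (h (n - i - j)))
              = (\<Oplus>j \<in> {..n - i}. (\<alpha> ^^ i) (g j \<otimes> (\<alpha> ^^ j) (h (n - i - j))))"
            using fgh by (intro endo_finsum[OF hom]) auto
          also have "\<dots> = (\<Oplus>j \<in> {..n - i}. (\<alpha> ^^ i) (g j) \<otimes> (\<alpha> ^^ (i + j)) (h (n - (i + j))))"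
            using fgh by (intro finsum_cong') (auto simp: ring_hom_mult[OF hom] funpow_add)
          also have "f i \<otimes> \<dots> = (\<Oplus>j \<in> {..n - i}. t i j)"
            unfolding t_def using fgh by (intro finsum_rdistr) auto
          finally show "(\<Oplus>j \<in> {..n - i}. t i j)
              = f i \<otimes> (\<alpha> ^^ i) (\<Oplus>j \<in> {..n - i}. g j \<otimes> (\<alpha> ^^ j) (h (n - i - j)))"
            by (rule sym)
        qed (use fgh in \<open>auto intro!: funpow_endo_closed[OF \<alpha>] finsum_closed\<close>)
        finally show "((f \<otimes>\<^bsub>?S\<^esub> g) \<otimes>\<^bsub>?S\<^esub> h) n = (f \<otimes>\<^bsub>?S\<^esub> (g \<otimes>\<^bsub>?S\<^esub> h)) n"
          by (simp add: skew_power_series_def)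
      qed
    qed
    show "(f \<oplus>\<^bsub>?S\<^esub> g) \<otimes>\<^bsub>?S\<^esub> h = f \<otimes>\<^bsub>?S\<^esub> h \<oplus>\<^bsub>?S\<^esub> g \<otimes>\<^bsub>?S\<^esub> h"
      if "f \<in> carrier ?S" "g \<in> carrier ?S" "h \<in> carrier ?S" for f g h
    proof
      fix n
      have fgh: "f \<in> UNIV \<rightarrow> carrier R" "g \<in> UNIV \<rightarrow> carrier R" "h \<in> UNIV \<rightarrow> carrier R"
        using that by (simp_all add: skew_power_series_def)
      have "(\<Oplus>i \<in> {..n}. (f i \<oplus> g i) \<otimes> (\<alpha> ^^ i) (h (n - i)))
          = (\<Oplus>i \<in> {..n}. f i \<otimes> (\<alpha> ^^ i) (h (n - i)) \<oplus> g i \<otimes> (\<alpha> ^^ i) (h (n - i)))"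
        using fgh by (intro finsum_cong') (auto simp: l_distr)
      also have "\<dots> = (\<Oplus>i \<in> {..n}. f i \<otimes> (\<alpha> ^^ i) (h (n - i)))
          \<oplus> (\<Oplus>i \<in> {..n}. g i \<otimes> (\<alpha> ^^ i) (h (n - i)))"
        using fgh by (intro finsum_addf) auto
      finally show "((f \<oplus>\<^bsub>?S\<^esub> g) \<otimes>\<^bsub>?S\<^esub> h) n = (f \<otimes>\<^bsub>?S\<^esub> h \<oplus>\<^bsub>?S\<^esub> g \<otimes>\<^bsub>?S\<^esub> h) n"
        by (simp add: skew_power_series_def)
    qed
    show "h \<otimes>\<^bsub>?S\<^esub> (f \<oplus>\<^bsub>?S\<^esub> g) = h \<otimes>\<^bsub>?S\<^esub> f \<oplus>\<^bsub>?S\<^esub> h \<otimes>\<^bsub>?S\<^esub> g"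
      if "f \<in> carrier ?S" "g \<in> carrier ?S" "h \<in> carrier ?S" for f g h
    proof
      fix n
      have fgh: "f \<in> UNIV \<rightarrow> carrier R" "g \<in> UNIV \<rightarrow> carrier R" "h \<in> UNIV \<rightarrow> carrier R"
        using that by (simp_all add: skew_power_series_def)
      have "(\<Oplus>i \<in> {..n}. h i \<otimes> (\<alpha> ^^ i) (f (n - i) \<oplus> g (n - i)))
          = (\<Oplus>i \<in> {..n}. h i \<otimes> (\<alpha> ^^ i) (f (n - i)) \<oplus> h i \<otimes> (\<alpha> ^^ i) (g (n - i)))"
        using fgh by (intro finsum_cong') (auto simp: r_distr ring_hom_add[OF hom])
      also have "\<dots> = (\<Oplus>i \<in> {..n}. h i \<otimes> (\<alpha> ^^ i) (f (n - i)))
          \<oplus> (\<Oplus>i \<in> {..n}. h i \<otimes> (\<alpha> ^^ i) (g (n - i)))"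
        using fgh by (intro finsum_addf) auto
      finally show "(h \<otimes>\<^bsub>?S\<^esub> (f \<oplus>\<^bsub>?S\<^esub> g)) n = (h \<otimes>\<^bsub>?S\<^esub> f \<oplus>\<^bsub>?S\<^esub> h \<otimes>\<^bsub>?S\<^esub> g) n"
        by (simp add: skew_power_series_def)
    qed
  qed
qed

end

end

theory Submission imports Defs begin

text \<open>
  A rigid endomorphism makes \<open>R\<close> reduced and is compatible, so that products may be commuted,
  interspersed with further factors and twisted by \<open>\<alpha>\<close> without affecting whether they vanish.
  Reducedness of the series ring then follows by looking at lowest coefficients. For the
  Archimedean property let \<open>f\<close> be a nonunit, so that \<open>a = f 0\<close> is a nonunit of \<open>R\<close>, and let
  \<open>g \<noteq> 0\<close> have order \<open>m\<close> and lie in all the right ideals generated by powers of \<open>f\<close>. Write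
  \<open>g = f\<^sup>n h\<close> with \<open>n > m\<close>. Every product contributing to a coefficient of \<open>f\<^sup>n\<close> of index at most
  \<open>m\<close> has a factor \<open>a\<close> up to twisting, and so kills everything killed by \<open>a\<close>. Comparing
  coefficients of index \<open>j < m\<close> gives \<open>a\<^sup>n h\<^sub>j = 0\<close> successively, hence \<open>a h\<^sub>j = 0\<close>, and
  finally \<open>g\<^sub>m = a\<^sup>n h\<^sub>m\<close>. As \<open>n\<close> is arbitrarily large,
  \<open>g\<^sub>m = 0\<close> because \<open>R\<close> is left Archimedean.
\<close>

context ring
begin

section \<open>Reduced and left Archimedean rings\<close>

text \<open>A vanishing power can be lowered one exponent at a time: \<open>a [^] Suc n\<close>
  squares to a multiple of \<open>a [^] Suc (Suc n)\<close>.\<close>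

lemma reduced_iff_square:
  "reduced R \<longleftrightarrow> (\<forall>a \<in> carrier R. a \<otimes> a = \<zero> \<longrightarrow> a = \<zero>)"
proof
  assume red: "reduced R"
  show "\<forall>a \<in> carrier R. a \<otimes> a = \<zero> \<longrightarrow> a = \<zero>"
  proof (intro ballI impI)
    fix a assume "a \<in> carrier R" "a \<otimes> a = \<zero>"
    then have "a [^] (2::nat) = \<zero>" by (simp add: numeral_2_eq_2)
    then have "nilpotent_elem R a"
      unfolding nilpotent_elem_def using \<open>a \<in> carrier R\<close> by (auto intro: exI[of _ "2::nat"])
    then show "a = \<zero>" using red by (simp add: reduced_def)
  qed
next
  assume sq: "\<forall>a \<in> carrier R. a \<otimes> a = \<zero> \<longrightarrow> a = \<zero>"
  have "a = \<zero>" if a: "a \<in> carrier R" and "a [^] Suc n = \<zero>" for a and n :: nat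
    using that(2)
  proof (induction n)
    case 0
    then show ?case using a by simp
  next
    case (Suc n)
    have "a [^] Suc n \<otimes> a [^] Suc n = a [^] Suc (Suc n) \<otimes> a [^] n"
      using a by (simp only: nat_pow_mult) simp
    with Suc.prems a have "a [^] Suc n \<otimes> a [^] Suc n = \<zero>" by simp
    with sq a have "a [^] Suc n = \<zero>" by (metis nat_pow_closed)
    then show ?case by (rule Suc.IH)
  qed
  then show "reduced R"
    unfolding reduced_def nilpotent_elem_def by (metis Suc_pred' less_eq_Suc_le One_nat_def)
qed

lemma reduced_square:
  assumes "reduced R" "a \<otimes> a = \<zero>" "a \<in> carrier R"
  shows "a = \<zero>"
  using assms unfolding reduced_iff_square by blast

text \<open>Zero lies in every right ideal, so only one inclusion has content; in this form
  witnesses \<open>r\<close> can be supplied and extracted directly.\<close>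

lemma left_archimedean_iff:
  "left_archimedean R \<longleftrightarrow>
    (\<forall>a \<in> carrier R - Units R. \<forall>b.
      (\<forall>n::nat. n \<ge> 1 \<longrightarrow> (\<exists>r \<in> carrier R. b = a [^] n \<otimes> r)) \<longrightarrow> b = \<zero>)"
proof -
  have "(\<Inter>n \<in> {1::nat..}. (a [^] n) <# carrier R) = {\<zero>} \<longleftrightarrow>
      (\<forall>b. (\<forall>n::nat. n \<ge> 1 \<longrightarrow> (\<exists>r \<in> carrier R. b = a [^] n \<otimes> r)) \<longrightarrow> b = \<zero>)"
    if a: "a \<in> carrier R" for a
  proof -
    have "\<zero> \<in> (\<Inter>n \<in> {1::nat..}. (a [^] n) <# carrier R)"
      using a by (auto simp: l_coset_def intro!: bexI[of _ \<zero>])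
    then show ?thesis
      by (auto simp: l_coset_def set_eq_iff)
  qed
  then show ?thesis by (simp add: left_archimedean_def)
qed

lemma reduced_mult_zero_commute:
  assumes "reduced R" "a \<otimes> b = \<zero>" "a \<in> carrier R" "b \<in> carrier R"
  shows "b \<otimes> a = \<zero>"
proof -
  have "(b \<otimes> a) \<otimes> (b \<otimes> a) = b \<otimes> (a \<otimes> b) \<otimes> a"
    using assms(3,4) by (simp add: m_assoc)
  also have "\<dots> = \<zero>" using assms(2-4) by simp
  finally show ?thesis by (rule reduced_square[OF assms(1)]) (use assms(3,4) in auto)
qed

text \<open>Commuting turns the inserted factor into an outer one, where it is harmless; commuting
  again brings it inside.\<close>

lemma reduced_mult_zero_insert:
  assumes "reduced R" "a \<otimes> b = \<zero>" "a \<in> carrier R" "r \<in> carrier R" "b \<in> carrier R"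
  shows "a \<otimes> (r \<otimes> b) = \<zero>"
proof -
  have "b \<otimes> a = \<zero>" by (rule reduced_mult_zero_commute[OF assms(1,2,3,5)])
  then have "(r \<otimes> b) \<otimes> a = \<zero>" using assms(3-5) by (simp add: m_assoc)
  then show ?thesis by (rule reduced_mult_zero_commute[OF assms(1)]) (use assms(3-5) in auto)
qed

lemma reduced_pow_mult_zero:
  fixes n :: nat
  assumes red: "reduced R" and "a [^] n \<otimes> b = \<zero>"
    and a: "a \<in> carrier R" and b: "b \<in> carrier R"
  shows "a \<otimes> b = \<zero>"
  using assms(2)
proof (induction n)
  case 0
  then show ?case using a b by simp
next
  case IH: (Suc n)
  let ?c = "b \<otimes> a [^] n"
  have "a [^] n \<otimes> (a \<otimes> b) = \<zero>"
    using IH.prems a b by (simp add: m_assoc)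
  then have "a \<otimes> ?c = \<zero>"
    using reduced_mult_zero_commute[OF red, of "a [^] n" "a \<otimes> b"] a b by (simp add: m_assoc)
  show ?case
  \<comment> \<open>For positive \<open>n\<close> the element \<open>?c\<close> ends in a factor
    \<open>a\<close>, which meets the next \<open>?c\<close> in its square and kills it. For
    \<open>n = 0\<close> there is no such factor, but \<open>?c\<close> is just
    \<open>b\<close>.\<close>
  proof (cases n)
    case 0
    then show ?thesis using \<open>a \<otimes> ?c = \<zero>\<close> b by simp
  next
    case (Suc k)
    have "a [^] n = a [^] k \<otimes> a" by (simp add: Suc)
    then have "?c \<otimes> ?c = b \<otimes> a [^] k \<otimes> (a \<otimes> ?c)" using a b by (simp add: m_assoc)
    also have "\<dots> = \<zero>" using a b \<open>a \<otimes> ?c = \<zero>\<close> by simp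
    finally have "?c = \<zero>" by (rule reduced_square[OF red]) (use a b in auto)
    then have "a [^] n \<otimes> b = \<zero>" by (rule reduced_mult_zero_commute[OF red, of b]) (use a b in auto)
    then show ?thesis by (rule IH.IH)
  qed
qed

section \<open>Rigid and compatible endomorphisms\<close>

lemma rigid_endoD:
  assumes "rigid_endo R \<alpha>" "a \<otimes> \<alpha> a = \<zero>" "a \<in> carrier R"
  shows "a = \<zero>"
  using assms unfolding rigid_endo_def by blast

text \<open>Rigidity is applied twice, first to \<open>a \<otimes> \<alpha> a\<close>, whose product
  with its own image contains \<open>\<alpha> (a \<otimes> a)\<close>, and then to
  \<open>a\<close>.\<close>

lemma rigid_imp_reduced:
  assumes \<alpha>: "\<alpha> \<in> ring_hom R R" and "rigid_endo R \<alpha>"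
  shows "reduced R"
  unfolding reduced_iff_square
proof (intro ballI impI)
  fix a assume a: "a \<in> carrier R" and "a \<otimes> a = \<zero>"
  have [simp]: "\<alpha> x \<in> carrier R" if "x \<in> carrier R" for x
    using \<alpha> that by (rule ring_hom_closed)
  have "(a \<otimes> \<alpha> a) \<otimes> \<alpha> (a \<otimes> \<alpha> a) = a \<otimes> \<alpha> (a \<otimes> a) \<otimes> \<alpha> (\<alpha> a)"
    using a by (simp add: ring_hom_mult[OF \<alpha>] m_assoc)
  also have "\<dots> = \<zero>"
    using a \<open>a \<otimes> a = \<zero>\<close> by (simp add: endo_zero[OF \<alpha>])
  finally have "a \<otimes> \<alpha> a = \<zero>" by (rule rigid_endoD[OF assms(2)]) (use a in auto)
  then show "a = \<zero>" using a by (rule rigid_endoD[OF assms(2)])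
qed

lemma rigid_imp_compatible:
  assumes \<alpha>: "\<alpha> \<in> ring_hom R R" and rigid: "rigid_endo R \<alpha>"
  shows "compatible_endo R \<alpha>"
  unfolding compatible_endo_def
proof (intro ballI iffI)
  fix a b assume a: "a \<in> carrier R" and b: "b \<in> carrier R"
  have [simp]: "\<alpha> x \<in> carrier R" if "x \<in> carrier R" for x
    using \<alpha> that by (rule ring_hom_closed)
  have red: "reduced R" using assms by (rule rigid_imp_reduced)
  {
    assume "a \<otimes> b = \<zero>"
    then have "b \<otimes> a = \<zero>" by (rule reduced_mult_zero_commute[OF red _ a b])
    have "(a \<otimes> \<alpha> b) \<otimes> \<alpha> (a \<otimes> \<alpha> b) = a \<otimes> \<alpha> (b \<otimes> a) \<otimes> \<alpha> (\<alpha> b)"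
      using a b by (simp add: ring_hom_mult[OF \<alpha>] m_assoc)
    also have "\<dots> = \<zero>"
      using a b \<open>b \<otimes> a = \<zero>\<close> by (simp add: endo_zero[OF \<alpha>])
    finally show "a \<otimes> \<alpha> b = \<zero>" by (rule rigid_endoD[OF rigid]) (use a b in auto)
  next
    assume "a \<otimes> \<alpha> b = \<zero>"
    \<comment> \<open>Rigidity is tested on the reversed product, so that
      \<open>a \<otimes> \<alpha> b\<close> appears in the middle.\<close>
    have "(b \<otimes> a) \<otimes> \<alpha> (b \<otimes> a) = b \<otimes> (a \<otimes> \<alpha> b) \<otimes> \<alpha> a"
      using a b by (simp add: ring_hom_mult[OF \<alpha>] m_assoc)
    also have "\<dots> = \<zero>"
      using a b \<open>a \<otimes> \<alpha> b = \<zero>\<close> by simp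
    finally have "b \<otimes> a = \<zero>" by (rule rigid_endoD[OF rigid]) (use a b in auto)
    then show "a \<otimes> b = \<zero>" by (rule reduced_mult_zero_commute[OF red _ b a])
  }
qed

lemma reduced_compatible_imp_rigid:
  assumes "reduced R" "compatible_endo R \<alpha>"
  shows "rigid_endo R \<alpha>"
  using assms unfolding reduced_iff_square compatible_endo_def rigid_endo_def by blast

lemma compatible_funpow:
  assumes \<alpha>: "\<alpha> \<in> ring_hom R R" and "compatible_endo R \<alpha>"
    and "a \<in> carrier R" "b \<in> carrier R"
  shows "a \<otimes> (\<alpha> ^^ k) b = \<zero> \<longleftrightarrow> a \<otimes> b = \<zero>"
  using assms(2-4) funpow_endo_closed[OF \<alpha>, of b]
  by (induction k) (auto simp: compatible_endo_def)

text \<open>Compatibility twists right-hand factors; commuting the vanishing product before and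
  after moves the twist to the left.\<close>

lemma compatible_funpow_left:
  assumes "\<alpha> \<in> ring_hom R R" "compatible_endo R \<alpha>" "reduced R"
    and "a \<otimes> b = \<zero>" "a \<in> carrier R" "b \<in> carrier R"
  shows "(\<alpha> ^^ k) a \<otimes> b = \<zero>"
  using assms compatible_funpow[of \<alpha> b a k] reduced_mult_zero_commute
    funpow_endo_closed[of \<alpha> a k] by blast

section \<open>Skew power series\<close>

lemma carrier_skew_power_series: "carrier (skew_power_series R \<alpha>) = UNIV \<rightarrow> carrier R"
  by (simp add: skew_power_series_def)

lemma mult_skew_power_series:
  "(f \<otimes>\<^bsub>skew_power_series R \<alpha>\<^esub> g) n = (\<Oplus>i \<in> {..n}. f i \<otimes> (\<alpha> ^^ i) (g (n - i)))"
  by (simp add: skew_power_series_def)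

lemma one_skew_power_series:
  "\<one>\<^bsub>skew_power_series R \<alpha>\<^esub> n = (if n = 0 then \<one> else \<zero>)"
  by (simp add: skew_power_series_def)

lemma zero_skew_power_series: "\<zero>\<^bsub>skew_power_series R \<alpha>\<^esub> = (\<lambda>n. \<zero>)"
  by (simp add: skew_power_series_def)

lemma mult_skew_power_series_0:
  assumes "f \<in> UNIV \<rightarrow> carrier R" "g \<in> UNIV \<rightarrow> carrier R"
  shows "(f \<otimes>\<^bsub>skew_power_series R \<alpha>\<^esub> g) 0 = f 0 \<otimes> g 0"
proof -
  have "f 0 \<in> carrier R" "g 0 \<in> carrier R" using assms by auto
  then show ?thesis by (simp add: mult_skew_power_series)
qed

lemma pow_skew_power_series_0:
  fixes k :: nat
  assumes "\<alpha> \<in> ring_hom R R" "f \<in> UNIV \<rightarrow> carrier R"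
  shows "(f [^]\<^bsub>skew_power_series R \<alpha>\<^esub> k) 0 = f 0 [^] k"
proof -
  interpret S: ring "skew_power_series R \<alpha>" using assms(1) by (rule skew_power_series_ring)
  have "f [^]\<^bsub>skew_power_series R \<alpha>\<^esub> k \<in> UNIV \<rightarrow> carrier R" for k :: nat
    using S.nat_pow_closed[of f k] assms(2) by (simp add: carrier_skew_power_series)
  then show ?thesis
    using assms(2) by (induction k) (simp_all add: one_skew_power_series mult_skew_power_series_0)
qed

section \<open>Monomials and constant series\<close>

definition skew_monom :: "nat \<Rightarrow> 'a \<Rightarrow> nat \<Rightarrow> 'a" where
  "skew_monom m a = (\<lambda>n. if n = m then a else \<zero>)"

lemma skew_monom_closed: "a \<in> carrier R \<Longrightarrow> skew_monom m a \<in> UNIV \<rightarrow> carrier R"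
  by (auto simp: skew_monom_def)

lemma skew_monom_mult:
  assumes \<alpha>: "\<alpha> \<in> ring_hom R R" and a: "a \<in> carrier R" and g: "g \<in> UNIV \<rightarrow> carrier R"
  shows "(skew_monom m a \<otimes>\<^bsub>skew_power_series R \<alpha>\<^esub> g) n
    = (if m \<le> n then a \<otimes> (\<alpha> ^^ m) (g (n - m)) else \<zero>)"
proof -
  have c: "(\<alpha> ^^ i) (g j) \<in> carrier R" for i j
    using g by (intro funpow_endo_closed[OF \<alpha>]) auto
  have "(skew_monom m a \<otimes>\<^bsub>skew_power_series R \<alpha>\<^esub> g) n
      = (\<Oplus>i \<in> {..n}. if i = m then a \<otimes> (\<alpha> ^^ i) (g (n - i)) else \<zero>)"
    unfolding mult_skew_power_series
    using a c by (intro finsum_cong') (auto simp: skew_monom_def)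
  also have "\<dots> = (if m \<le> n then a \<otimes> (\<alpha> ^^ m) (g (n - m)) else \<zero>)"
    using a c by (subst finsum_delta_nat) auto
  finally show ?thesis .
qed

lemma skew_const_mult:
  assumes "\<alpha> \<in> ring_hom R R" "a \<in> carrier R" "g \<in> UNIV \<rightarrow> carrier R"
  shows "skew_monom 0 a \<otimes>\<^bsub>skew_power_series R \<alpha>\<^esub> g = (\<lambda>n. a \<otimes> g n)"
  using assms by (auto simp: skew_monom_mult)

lemma skew_const_pow:
  fixes k :: nat
  assumes "\<alpha> \<in> ring_hom R R" "a \<in> carrier R"
  shows "skew_monom 0 a [^]\<^bsub>skew_power_series R \<alpha>\<^esub> k = skew_monom 0 (a [^] k)"
proof (induction k)
  case 0
  show ?case by (auto simp: skew_monom_def skew_power_series_def)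
next
  case (Suc k)
  interpret S: ring "skew_power_series R \<alpha>" using assms(1) by (rule skew_power_series_ring)
  have "skew_monom 0 a [^]\<^bsub>skew_power_series R \<alpha>\<^esub> Suc k
      = (\<lambda>n. a [^] k \<otimes> skew_monom 0 a n)"
    using assms by (simp add: Suc skew_const_mult skew_monom_closed)
  also have "\<dots> = skew_monom 0 (a [^] Suc k)"
    using assms by (auto simp: skew_monom_def)
  finally show ?case .
qed

section \<open>Units of the series ring\<close>

text \<open>The second condition inside \<open>if\<close> only serves termination.\<close>

fun right_inverse_coeff :: "('a \<Rightarrow> 'a) \<Rightarrow> (nat \<Rightarrow> 'a) \<Rightarrow> nat \<Rightarrow> 'a" where
  "right_inverse_coeff \<alpha> f n = inv (f 0) \<otimes> ((if n = 0 then \<one> else \<zero>) \<ominus>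
     (\<Oplus>i \<in> {..n}. if i = 0 \<or> n < i then \<zero>
       else f i \<otimes> (\<alpha> ^^ i) (right_inverse_coeff \<alpha> f (n - i))))"

declare right_inverse_coeff.simps [simp del]

text \<open>The coefficients solve \<open>f \<otimes> h = 1\<close> degree by degree, dividing by
  \<open>f 0\<close> on the left. That \<open>h 0\<close> is a unit is recorded so that the
  construction can be repeated for \<open>h\<close>.\<close>

lemma skew_power_series_right_inverse:
  assumes \<alpha>: "\<alpha> \<in> ring_hom R R" and f: "f \<in> UNIV \<rightarrow> carrier R" and unit: "f 0 \<in> Units R"
  obtains h where "h \<in> UNIV \<rightarrow> carrier R" "h 0 \<in> Units R"
    "f \<otimes>\<^bsub>skew_power_series R \<alpha>\<^esub> h = \<one>\<^bsub>skew_power_series R \<alpha>\<^esub>"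
proof -
  define h where "h = right_inverse_coeff \<alpha> f"
  define s where "s n = (\<Oplus>i \<in> {..n}. if i = 0 \<or> n < i then \<zero> else f i \<otimes> (\<alpha> ^^ i) (h (n - i)))" for n
  have h_eq: "h n = inv (f 0) \<otimes> ((if n = 0 then \<one> else \<zero>) \<ominus> s n)" for n
    unfolding h_def s_def by (rule right_inverse_coeff.simps)
  have fc [simp]: "f i \<in> carrier R" for i using f by auto
  \<comment> \<open>The nonzero terms of \<open>s n\<close> have \<open>0 < i \<le> n\<close> and
    thus involve only earlier values of \<open>h\<close>.\<close>
  have hc: "h n \<in> carrier R" for n
  proof (induction n rule: less_induct)
    case (less n)
    have "s n \<in> carrier R"
      unfolding s_def using less by (auto intro!: finsum_closed m_closed funpow_endo_closed[OF \<alpha>])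
    then show ?case using unit by (simp add: h_eq[of n])
  qed
  have tc: "f i \<otimes> (\<alpha> ^^ i) (h j) \<in> carrier R" for i j
    by (simp add: hc funpow_endo_closed[OF \<alpha>])
  have sc: "s n \<in> carrier R" for n
    unfolding s_def using tc by (auto intro!: finsum_closed)
  have "(f \<otimes>\<^bsub>skew_power_series R \<alpha>\<^esub> h) n = \<one>\<^bsub>skew_power_series R \<alpha>\<^esub> n" for n
  proof -
    \<comment> \<open>The term \<open>i = 0\<close>, which contains the newly chosen
      \<open>h n\<close>, is separated from the rest \<open>s n\<close>.\<close>
    have "(f \<otimes>\<^bsub>skew_power_series R \<alpha>\<^esub> h) n
        = (\<Oplus>i \<in> {..n}. (if i = 0 then f i \<otimes> (\<alpha> ^^ i) (h (n - i)) else \<zero>)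
            \<oplus> (if i = 0 \<or> n < i then \<zero> else f i \<otimes> (\<alpha> ^^ i) (h (n - i))))"
      unfolding mult_skew_power_series using tc hc by (intro finsum_cong') auto
    also have "\<dots> = (\<Oplus>i \<in> {..n}. if i = 0 then f i \<otimes> (\<alpha> ^^ i) (h (n - i)) else \<zero>) \<oplus> s n"
      unfolding s_def using tc hc by (intro finsum_addf) auto
    also have "(\<Oplus>i \<in> {..n}. if i = 0 then f i \<otimes> (\<alpha> ^^ i) (h (n - i)) else \<zero>) = f 0 \<otimes> h n"
      using tc by (subst finsum_delta_nat) auto
    also have "f 0 \<otimes> h n = (if n = 0 then \<one> else \<zero>) \<ominus> s n"
      unfolding h_eq[of n] using unit sc by (simp add: m_assoc[symmetric])
    also have "\<dots> \<oplus> s n = (if n = 0 then \<one> else \<zero>)"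
      using sc[of n] by (simp add: minus_eq a_assoc l_neg)
    finally show ?thesis by (simp add: one_skew_power_series)
  qed
  moreover have "h 0 \<in> Units R"
    using unit by (simp add: h_eq[of 0] s_def minus_eq)
  ultimately show ?thesis using hc by (intro that[of h]) auto
qed

text \<open>Constant terms multiply, which gives one direction. For the other, a right inverse
  \<open>h\<close> of \<open>f\<close> itself has a right inverse \<open>k\<close>, and then
  \<open>f = f h k = k\<close>, so \<open>h\<close> is two-sided.\<close>

lemma Units_skew_power_series:
  assumes \<alpha>: "\<alpha> \<in> ring_hom R R" and f: "f \<in> UNIV \<rightarrow> carrier R"
  shows "f \<in> Units (skew_power_series R \<alpha>) \<longleftrightarrow> f 0 \<in> Units R"
proof
  interpret S: ring "skew_power_series R \<alpha>" using \<alpha> by (rule skew_power_series_ring)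
  {
    assume "f \<in> Units (skew_power_series R \<alpha>)"
    then obtain g where g: "g \<in> UNIV \<rightarrow> carrier R"
      and "g \<otimes>\<^bsub>skew_power_series R \<alpha>\<^esub> f = \<one>\<^bsub>skew_power_series R \<alpha>\<^esub>"
        "f \<otimes>\<^bsub>skew_power_series R \<alpha>\<^esub> g = \<one>\<^bsub>skew_power_series R \<alpha>\<^esub>"
      unfolding Units_def by (auto simp: carrier_skew_power_series)
    then have "g 0 \<otimes> f 0 = \<one>" "f 0 \<otimes> g 0 = \<one>"
      using f by (metis mult_skew_power_series_0 one_skew_power_series)+
    moreover have "f 0 \<in> carrier R" "g 0 \<in> carrier R" using f g by auto
    ultimately show "f 0 \<in> Units R" unfolding Units_def by auto
  next
    assume "f 0 \<in> Units R"
    then obtain h where h: "h \<in> UNIV \<rightarrow> carrier R" "h 0 \<in> Units R"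
      and fh: "f \<otimes>\<^bsub>skew_power_series R \<alpha>\<^esub> h = \<one>\<^bsub>skew_power_series R \<alpha>\<^esub>"
      using skew_power_series_right_inverse[OF \<alpha> f] by blast
    obtain k where k: "k \<in> UNIV \<rightarrow> carrier R"
      and hk: "h \<otimes>\<^bsub>skew_power_series R \<alpha>\<^esub> k = \<one>\<^bsub>skew_power_series R \<alpha>\<^esub>"
      using skew_power_series_right_inverse[OF \<alpha> h] by blast
    have "f = k"
      using f h k fh hk by (metis S.inv_unique carrier_skew_power_series)
    then show "f \<in> Units (skew_power_series R \<alpha>)"
      using f h fh hk unfolding Units_def by (auto simp: carrier_skew_power_series)
  }
qed

section \<open>Passing from the coefficient ring to the series ring\<close>

lemma reduced_skew_power_series:
  assumes \<alpha>: "\<alpha> \<in> ring_hom R R" and red: "reduced R" and comp: "compatible_endo R \<alpha>"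
  shows "reduced (skew_power_series R \<alpha>)"
proof -
  interpret S: ring "skew_power_series R \<alpha>" using \<alpha> by (rule skew_power_series_ring)
  have "f n = \<zero>" if f: "f \<in> UNIV \<rightarrow> carrier R"
    and sq: "f \<otimes>\<^bsub>skew_power_series R \<alpha>\<^esub> f = (\<lambda>n. \<zero>)" for f n
  proof (induction n rule: less_induct)
    case (less n)
    have c: "f i \<in> carrier R" "(\<alpha> ^^ i) (f j) \<in> carrier R" for i j
      using f by (auto intro: funpow_endo_closed[OF \<alpha>])
    \<comment> \<open>In degree \<open>n + n\<close> of the square, every term with
      \<open>i \<noteq> n\<close> has a factor built from a coefficient of index below
      \<open>n\<close>, already known to vanish.\<close>
    have "\<zero> = (\<Oplus>i \<in> {..n + n}. f i \<otimes> (\<alpha> ^^ i) (f (n + n - i)))"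
      using fun_cong[OF sq, of "n + n"] by (simp add: mult_skew_power_series)
    also have "\<dots> = (\<Oplus>i \<in> {..n + n}. if i = n then f i \<otimes> (\<alpha> ^^ i) (f (n + n - i)) else \<zero>)"
    proof (rule finsum_cong')
      fix i assume "i \<in> {..n + n}"
      consider "i < n" | "i = n" | "n + n - i < n" using \<open>i \<in> {..n + n}\<close> by force
      then show "f i \<otimes> (\<alpha> ^^ i) (f (n + n - i))
          = (if i = n then f i \<otimes> (\<alpha> ^^ i) (f (n + n - i)) else \<zero>)"
        by cases (auto simp: c less endo_zero[OF funpow_endo[OF \<alpha>]])
    qed (auto simp: c)
    also have "\<dots> = f n \<otimes> (\<alpha> ^^ n) (f n)"
      by (subst finsum_delta_nat) (auto simp: c)
    finally have "f n \<otimes> f n = \<zero>"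
      using compatible_funpow[OF \<alpha> comp c(1) c(1), of n n n] by metis
    then show ?case by (rule reduced_square[OF red]) (use c in auto)
  qed
  then show ?thesis
    unfolding S.reduced_iff_square carrier_skew_power_series zero_skew_power_series by blast
qed

text \<open>Indices of \<open>n\<close> coefficients adding up to \<open>i < n\<close> cannot all be
  positive, so each contributing product contains a possibly twisted \<open>f 0\<close>; neither the
  twist nor the surrounding factors prevent it from killing \<open>c\<close>.\<close>

lemma low_coeff_pow_annihilates:
  assumes \<alpha>: "\<alpha> \<in> ring_hom R R" and red: "reduced R" and comp: "compatible_endo R \<alpha>"
    and f: "f \<in> UNIV \<rightarrow> carrier R" and c: "c \<in> carrier R" and "f 0 \<otimes> c = \<zero>" and "i < n"
  shows "(f [^]\<^bsub>skew_power_series R \<alpha>\<^esub> n) i \<otimes> c = \<zero>"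
  using \<open>i < n\<close>
proof (induction n arbitrary: i)
  case 0
  then show ?case by simp
next
  case (Suc n)
  interpret S: ring "skew_power_series R \<alpha>" using \<alpha> by (rule skew_power_series_ring)
  define p where "p = f [^]\<^bsub>skew_power_series R \<alpha>\<^esub> n"
  have "p \<in> UNIV \<rightarrow> carrier R"
    using S.nat_pow_closed[of f n] f by (simp add: carrier_skew_power_series p_def)
  then have cl [simp]: "f k \<in> carrier R" "p j \<in> carrier R" "(\<alpha> ^^ k) (p j) \<in> carrier R" for j k
    using f by (auto intro: funpow_endo_closed[OF \<alpha>])
  \<comment> \<open>The extra factor is put on the left, so that the coefficient of \<open>p\<close>
    stands next to \<open>c\<close>, where the induction hypothesis applies.\<close>
  have "f [^]\<^bsub>skew_power_series R \<alpha>\<^esub> Suc n = f \<otimes>\<^bsub>skew_power_series R \<alpha>\<^esub> p"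
    using f S.nat_pow_Suc2[of f n] by (simp add: carrier_skew_power_series p_def)
  then have "(f [^]\<^bsub>skew_power_series R \<alpha>\<^esub> Suc n) i \<otimes> c
      = (\<Oplus>k \<in> {..i}. f k \<otimes> (\<alpha> ^^ k) (p (i - k)) \<otimes> c)"
    unfolding mult_skew_power_series[symmetric]
    using c by (simp only: mult_skew_power_series) (intro finsum_ldistr, auto)
  also have "\<dots> = (\<Oplus>k \<in> {..i}. \<zero>)"
  proof (rule finsum_cong')
    fix k assume "k \<in> {..i}"
    show "f k \<otimes> (\<alpha> ^^ k) (p (i - k)) \<otimes> c = \<zero>"
    \<comment> \<open>For \<open>k = 0\<close> the index \<open>i\<close> may equal
      \<open>n\<close>, beyond the induction hypothesis, but then \<open>f 0\<close> is in front.
      For \<open>k > 0\<close> the index \<open>i - k\<close> is below \<open>n\<close>.\<close>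
    proof (cases "k = 0")
      case True
      then show ?thesis
        using reduced_mult_zero_insert[OF red assms(6), of "p i"] c by (simp add: m_assoc)
    next
      case False
      then have "p (i - k) \<otimes> c = \<zero>"
        unfolding p_def using Suc.prems \<open>k \<in> {..i}\<close> by (intro Suc.IH) auto
      then have "(\<alpha> ^^ k) (p (i - k)) \<otimes> c = \<zero>"
        by (rule compatible_funpow_left[OF \<alpha> comp red]) (use c in auto)
      then show ?thesis using c by (simp add: m_assoc)
    qed
  qed auto
  finally show ?case by simp
qed

lemma left_archimedean_skew_power_series:
  assumes \<alpha>: "\<alpha> \<in> ring_hom R R" and red: "reduced R" and comp: "compatible_endo R \<alpha>"
    and arch: "left_archimedean R"
  shows "left_archimedean (skew_power_series R \<alpha>)"
proof -
  let ?S = "skew_power_series R \<alpha>"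
  interpret S: ring ?S using \<alpha> by (rule skew_power_series_ring)
  have "g = \<zero>\<^bsub>?S\<^esub>" if f: "f \<in> carrier ?S" "f \<notin> Units ?S"
    and g: "\<And>n::nat. n \<ge> 1 \<Longrightarrow> \<exists>h \<in> carrier ?S. g = f [^]\<^bsub>?S\<^esub> n \<otimes>\<^bsub>?S\<^esub> h" for f g
  proof -
    have f': "f \<in> UNIV \<rightarrow> carrier R" using f(1) by (simp add: carrier_skew_power_series)
    have a: "f 0 \<in> carrier R - Units R"
      using f' f(2) Units_skew_power_series[OF \<alpha> f'] by auto
    have "g m = \<zero>" for m
    proof (induction m rule: less_induct)
      case (less m)
      have "\<exists>r \<in> carrier R. g m = f 0 [^] k \<otimes> r" for k :: nat
      proof -
        \<comment> \<open>Being larger than \<open>m\<close>, this exponent makes all coefficients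
          of \<open>p\<close> up to index \<open>m\<close> annihilate what \<open>f 0\<close>
          annihilates; being at least \<open>k\<close>, it lets \<open>f 0 [^] k\<close> be split
          off.\<close>
        define n where "n = k + m + 1"
        obtain h where h: "h \<in> UNIV \<rightarrow> carrier R" and gh: "g = f [^]\<^bsub>?S\<^esub> n \<otimes>\<^bsub>?S\<^esub> h"
          using g[of n] by (auto simp: n_def carrier_skew_power_series)
        define p where "p = f [^]\<^bsub>?S\<^esub> n"
        have "p \<in> UNIV \<rightarrow> carrier R"
          using S.nat_pow_closed[of f n] f by (simp add: carrier_skew_power_series p_def)
        then have cl [simp]: "f i \<in> carrier R" "p i \<in> carrier R" "h i \<in> carrier R"
            "(\<alpha> ^^ i) (h j) \<in> carrier R" for i j
          using f' h by (auto intro: funpow_endo_closed[OF \<alpha>])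
        have p0: "p 0 = f 0 [^] n"
          unfolding p_def by (rule pow_skew_power_series_0) fact+
        have lead: "g j = f 0 [^] n \<otimes> h j"
          \<comment> \<open>Terms with \<open>i > 0\<close> involve \<open>h (j - i)\<close>, killed
            by \<open>f 0\<close> and hence by \<open>p i\<close>, since
            \<open>i \<le> m < n\<close>.\<close>
          if "j \<le> m" and killed: "\<And>i. i < j \<Longrightarrow> f 0 \<otimes> h i = \<zero>" for j
        proof -
          have "g j = (\<Oplus>i \<in> {..j}. p i \<otimes> (\<alpha> ^^ i) (h (j - i)))"
            by (simp add: gh p_def mult_skew_power_series)
          also have "\<dots> = (\<Oplus>i \<in> {..j}. if i = 0 then p i \<otimes> (\<alpha> ^^ i) (h (j - i)) else \<zero>)"
          proof (rule finsum_cong')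
            fix i assume "i \<in> {..j}"
            have "p i \<otimes> (\<alpha> ^^ i) (h (j - i)) = \<zero>" if "i \<noteq> 0"
            proof -
              have "p i \<otimes> h (j - i) = \<zero>"
                unfolding p_def
                by (rule low_coeff_pow_annihilates[OF \<alpha> red comp f'])
                  (use that \<open>i \<in> {..j}\<close> \<open>j \<le> m\<close> killed[of "j - i"] in \<open>auto simp: n_def\<close>)
              then show ?thesis by (simp add: compatible_funpow[OF \<alpha> comp])
            qed
            then show "p i \<otimes> (\<alpha> ^^ i) (h (j - i))
                = (if i = 0 then p i \<otimes> (\<alpha> ^^ i) (h (j - i)) else \<zero>)" by simp
          qed auto
          also have "\<dots> = f 0 [^] n \<otimes> h j"
            by (subst finsum_delta_nat) (auto simp: p0)
          finally show ?thesis .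
        qed
        \<comment> \<open>The outer induction gives \<open>g j = \<zero>\<close>, and
          \<open>lead\<close> turns this into a statement about \<open>h j\<close>; the inner
          induction supplies the premise of \<open>lead\<close>.\<close>
        have "f 0 \<otimes> h j = \<zero>" if "j < m" for j
          using that
        proof (induction j rule: less_induct)
          case (less j)
          then have "f 0 [^] n \<otimes> h j = \<zero>"
            using lead[of j] \<open>\<And>j. j < m \<Longrightarrow> g j = \<zero>\<close> by simp
          then show ?case by (rule reduced_pow_mult_zero[OF red]) auto
        qed
        then have "g m = f 0 [^] n \<otimes> h m" by (intro lead) auto
        also have "\<dots> = f 0 [^] k \<otimes> (f 0 [^] (m + 1) \<otimes> h m)"
          by (simp add: n_def m_assoc[symmetric] nat_pow_mult del: nat_pow_Suc)
        finally show ?thesis by (intro bexI[of _ "f 0 [^] (m + 1) \<otimes> h m"]) auto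
      qed
      \<comment> \<open>Although \<open>h\<close> depends on \<open>k\<close>, the element
        \<open>g m\<close> does not, so it lies in every right ideal generated by a power of
        \<open>f 0\<close>.\<close>
      then show ?case using arch a unfolding left_archimedean_iff by blast
    qed
    then show ?thesis by (auto simp: zero_skew_power_series)
  qed
  then show ?thesis unfolding S.left_archimedean_iff by blast
qed

section \<open>Passing from the series ring to the coefficient ring\<close>

text \<open>Constant series carry nonunits to nonunits and preserve powers and products, so a
  counterexample in \<open>R\<close> would give one among the series.\<close>

lemma left_archimedean_skew_power_seriesD:
  assumes \<alpha>: "\<alpha> \<in> ring_hom R R" and arch: "left_archimedean (skew_power_series R \<alpha>)"
  shows "left_archimedean R"
proof -
  let ?S = "skew_power_series R \<alpha>"
  interpret S: ring ?S using \<alpha> by (rule skew_power_series_ring)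
  have "b = \<zero>" if a: "a \<in> carrier R" "a \<notin> Units R"
    and b: "\<And>n::nat. n \<ge> 1 \<Longrightarrow> \<exists>r \<in> carrier R. b = a [^] n \<otimes> r" for a b
  proof -
    have "skew_monom 0 a \<in> carrier ?S - Units ?S"
      using a Units_skew_power_series[OF \<alpha> skew_monom_closed, of a 0]
      by (auto simp: carrier_skew_power_series skew_monom_closed skew_monom_def)
    moreover have "\<exists>h \<in> carrier ?S. skew_monom 0 b = skew_monom 0 a [^]\<^bsub>?S\<^esub> n \<otimes>\<^bsub>?S\<^esub> h"
      if "n \<ge> 1" for n :: nat
    proof -
      obtain r where "r \<in> carrier R" "b = a [^] n \<otimes> r" using b \<open>n \<ge> 1\<close> by blast
      then show ?thesis
        using a by (intro bexI[of _ "skew_monom 0 r"])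
          (simp_all add: carrier_skew_power_series skew_monom_closed skew_const_pow[OF \<alpha>]
            skew_const_mult[OF \<alpha>], simp add: skew_monom_def fun_eq_iff)
    qed
    ultimately have "skew_monom 0 b = \<zero>\<^bsub>?S\<^esub>"
      using arch unfolding S.left_archimedean_iff by blast
    then show "b = \<zero>"
      by (metis skew_monom_def zero_skew_power_series)
  qed
  then show ?thesis unfolding left_archimedean_iff by blast
qed

text \<open>The square of \<open>a x\<close> is \<open>a \<alpha>(a) x\<^sup>2\<close>.\<close>

lemma reduced_skew_power_series_imp_rigid:
  assumes \<alpha>: "\<alpha> \<in> ring_hom R R" and red: "reduced (skew_power_series R \<alpha>)"
  shows "rigid_endo R \<alpha>"
  unfolding rigid_endo_def
proof (intro ballI impI)
  let ?S = "skew_power_series R \<alpha>"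
  interpret S: ring ?S using \<alpha> by (rule skew_power_series_ring)
  fix a assume a: "a \<in> carrier R" and "a \<otimes> \<alpha> a = \<zero>"
  then have "skew_monom 1 a \<otimes>\<^bsub>?S\<^esub> skew_monom 1 a = \<zero>\<^bsub>?S\<^esub>"
    using endo_zero[OF \<alpha>]
    by (auto simp: skew_monom_mult[OF \<alpha>] skew_monom_closed zero_skew_power_series fun_eq_iff)
      (auto simp: skew_monom_def)
  then have "skew_monom 1 a = \<zero>\<^bsub>?S\<^esub>"
    using red a skew_monom_closed
    unfolding S.reduced_iff_square carrier_skew_power_series by blast
  then show "a = \<zero>" by (metis skew_monom_def zero_skew_power_series)
qed

end

theorem theorem4p5:
  fixes R :: "('a, 'm) ring_scheme" and \<alpha> :: "'a \<Rightarrow> 'a"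
  assumes "ring R" and "\<alpha> \<in> ring_hom R R"
  shows "((reduced (skew_power_series R \<alpha>) \<and> left_archimedean (skew_power_series R \<alpha>))
            \<longleftrightarrow> (left_archimedean R \<and> rigid_endo R \<alpha>))
       \<and> ((left_archimedean R \<and> rigid_endo R \<alpha>)
            \<longleftrightarrow> (reduced R \<and> left_archimedean R \<and> compatible_endo R \<alpha>))"
proof -
  interpret ring R by fact
  \<comment> \<open>The implications used are (i) to (ii) to (iii) to (i), together with (iii) to
    (ii).\<close>
  show ?thesis
    using assms(2) rigid_imp_reduced rigid_imp_compatible reduced_compatible_imp_rigid
      reduced_skew_power_series left_archimedean_skew_power_series
      left_archimedean_skew_power_seriesD reduced_skew_power_series_imp_rigid
    by blast
qed

end
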